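(* Let $\lambda\in(2/3,1)$ and let $S$ be the set of all two-qubit states with spectrum $(\lambda,1-\lambda,0,0)$. Then there is no state $\rho\in S$ such that for every $\sigma\in S$ there exists a non-entangling (NE) map $\Lambda$ with $\Lambda(\rho)=\sigma$.
   Context: $\mathcal{D}$ denotes the set of two-qubit states, i.e. $4\times4$ unit-trace Hermitian positive semidefinite complex matrices acting on $\mathbb{C}^2\otimes\mathbb{C}^2$; the spectrum of a state is the list of its eigenvalues counted with multiplicity, in non-increasing order. $\mathcal{S}_{\mathrm{sep}}\subset\mathcal{D}$ denotes the set of separable states, i.e. those $\rho\in\mathcal{D}$ that can be written as $\rho=\sum_i p_i|\psi_i\rangle\langle\psi_i|\otimes|\chi_i\rangle\langle\chi_i|$ for some convex weights $\{p_i\}$ and unit vectors $|\psi_i\rangle,|\chi_i\rangle\in\mathbb{C}^2$. A completely positive and trace-preserving (linear) map $\Lambda$ on $4\times4$ complex matrices, viewed as a map $\mathcal{D}\to\mathcal{D}$, is non-entangling (NE) if $\Lambda(\rho)\in\mathcal{S}_{\mathrm{sep}}$ for all $\rho\in\mathcal{S}_{\mathrm{sep}}$. *)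

theory Defs
  imports "HOL-Analysis.Analysis"
begin

text \<open>Operators on \<open>\<complex>\<^sup>2 \<otimes> \<complex>\<^sup>2\<close>: rows and columns are indexed by pairs, the first component
  belonging to the first tensor factor.\<close>

type_synonym two_qubit_op = "complex ^ (2 \<times> 2) ^ (2 \<times> 2)"

definition kron :: "complex ^ 2 ^ 2 \<Rightarrow> complex ^ 2 ^ 2 \<Rightarrow> two_qubit_op" where
  "kron A B = (\<chi> i j. A $ fst i $ fst j * B $ snd i $ snd j)"

text \<open>The rank-one operator \<open>|\<psi>\<rangle>\<langle>\<psi>|\<close>.\<close>

definition ket_bra :: "complex ^ 'n \<Rightarrow> complex ^ 'n ^ 'n" where
  "ket_bra \<psi> = (\<chi> i j. \<psi> $ i * cnj (\<psi> $ j))"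

text \<open>Hermitian positive semidefiniteness for matrices over an arbitrary finite index set, so that
  one notion serves the \<open>4 \<times> 4\<close> matrices and all their ampliations in the definition of
  complete positivity.\<close>

definition psd_on :: "'a set \<Rightarrow> ('a \<Rightarrow> 'a \<Rightarrow> complex) \<Rightarrow> bool" where
  "psd_on I M \<longleftrightarrow>
     (\<forall>i\<in>I. \<forall>j\<in>I. M j i = cnj (M i j)) \<and>
     (\<forall>v. 0 \<le> Re (\<Sum>i\<in>I. \<Sum>j\<in>I. cnj (v i) * M i j * v j))"

definition two_qubit_states :: "two_qubit_op set" where
  "two_qubit_states = {\<rho>. psd_on UNIV (\<lambda>i j. \<rho> $ i $ j) \<and> trace \<rho> = 1}"

text \<open>\<open>es\<close> is the non-increasing list of the eigenvalues of \<open>A\<close> with multiplicity, i.e. of the roots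
  of the characteristic polynomial; \<open>mat x\<close> is \<open>x\<close> times the identity.\<close>

definition has_spectrum :: "complex ^ 'n ^ 'n \<Rightarrow> real list \<Rightarrow> bool" where
  "has_spectrum A es \<longleftrightarrow>
     sorted_wrt (\<ge>) es \<and>
     (\<forall>x. det (mat x - A) = (\<Prod>e\<leftarrow>es. x - complex_of_real e))"

definition separable_states :: "two_qubit_op set" where
  "separable_states = {\<rho> \<in> two_qubit_states.
     \<exists>(n::nat) (p :: nat \<Rightarrow> real) (\<psi> :: nat \<Rightarrow> complex ^ 2) (\<phi> :: nat \<Rightarrow> complex ^ 2).
       (\<forall>i<n. 0 \<le> p i) \<and> (\<Sum>i<n. p i) = 1 \<and>
       (\<forall>i<n. norm (\<psi> i) = 1 \<and> norm (\<phi> i) = 1) \<and>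
       \<rho> = (\<Sum>i<n. p i *\<^sub>R kron (ket_bra (\<psi> i)) (ket_bra (\<phi> i)))}"

definition cscale :: "complex \<Rightarrow> two_qubit_op \<Rightarrow> two_qubit_op" where
  "cscale c A = (\<chi> i j. c * A $ i $ j)"

text \<open>Positivity of \<open>id\<^sub>k \<otimes> \<Lambda>\<close> for every \<open>k\<close>: an operator on \<open>\<complex>\<^sup>k \<otimes> (\<complex>\<^sup>2 \<otimes> \<complex>\<^sup>2)\<close> is given by its
  blocks \<open>X i j\<close> with \<open>i, j < k\<close>, and \<open>\<Lambda>\<close> is applied to each block.\<close>

definition completely_positive :: "(two_qubit_op \<Rightarrow> two_qubit_op) \<Rightarrow> bool" where
  "completely_positive \<Lambda> \<longleftrightarrow>
     (\<forall>(k::nat) (X :: nat \<Rightarrow> nat \<Rightarrow> two_qubit_op).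
        psd_on ({..<k} \<times> UNIV) (\<lambda>(i, a) (j, b). X i j $ a $ b) \<longrightarrow>
        psd_on ({..<k} \<times> UNIV) (\<lambda>(i, a) (j, b). \<Lambda> (X i j) $ a $ b))"

definition cptp :: "(two_qubit_op \<Rightarrow> two_qubit_op) \<Rightarrow> bool" where
  "cptp \<Lambda> \<longleftrightarrow>
     Vector_Spaces.linear cscale cscale \<Lambda> \<and>
     completely_positive \<Lambda> \<and>
     (\<forall>X. trace (\<Lambda> X) = trace X)"

definition non_entangling :: "(two_qubit_op \<Rightarrow> two_qubit_op) \<Rightarrow> bool" where
  "non_entangling \<Lambda> \<longleftrightarrow> cptp \<Lambda> \<and> (\<forall>\<rho>\<in>separable_states. \<Lambda> \<rho> \<in> separable_states)"

end

theory Submission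
  imports Defs
begin

text \<open>Write a candidate source state as \<open>\<rho> = \<lambda> |v\<rangle>\<langle>v| + (1 - \<lambda>) |w\<rangle>\<langle>w|\<close> and let \<open>\<Phi>\<^sup>\<plusminus>\<close> be the Bell states
  \<open>(|11\<rangle> \<plusminus> |22\<rangle>) / \<surd>2\<close>. Two targets in \<open>S\<close> suffice for a contradiction.

  The plane spanned by \<open>v\<close> and \<open>w\<close> contains a product vector \<open>u\<close>. If \<open>\<Lambda>\<close> maps \<open>\<rho>\<close> to
  \<open>\<lambda> \<Phi>\<^sup>+ + (1 - \<lambda>) |12\<rangle>\<langle>12|\<close>, then \<open>\<Lambda>(|u\<rangle>\<langle>u|)\<close> is a separable state supported in the range of the target,
  whose only product vector is \<open>|12\<rangle>\<close>; so its fidelity with \<open>\<Phi>\<^sup>+\<close> vanishes, which forces \<open>u\<close> to be \<open>w\<close>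
  up to a phase and \<open>\<Lambda>(|v\<rangle>\<langle>v|)\<close> to have fidelity 1. As separable states have fidelity at most 1/2, \<open>v\<close> has
  squared overlap at most 1/2 with every product vector, i.e. it is maximally entangled.

  If \<open>\<Lambda>\<close> maps \<open>\<rho>\<close> to \<open>\<lambda> \<Phi>\<^sup>+ + (1 - \<lambda>) \<Phi>\<^sup>-\<close>, then \<open>\<Lambda>(|w\<rangle>\<langle>w|)\<close> is separable and supported in the span of
  \<open>|11\<rangle>\<close> and \<open>|22\<rangle>\<close>, so its fidelity \<open>f w\<close> with \<open>\<Phi>\<^sup>+\<close> is 1/2. Averaging the bound \<open>f \<le> 1/2\<close> over product
  vectors gives \<open>2 f v + f w \<le> 2\<close>, hence \<open>f v \<le> 3/4\<close>, and \<open>\<lambda> f v + (1 - \<lambda>) f w = \<lambda>\<close> then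
  yields \<open>\<lambda> \<le> 2/3\<close>.\<close>

section \<open>Positive semidefinite matrices and their spectral decomposition\<close>

definition cdot :: "complex ^ 'n \<Rightarrow> complex ^ 'n \<Rightarrow> complex" where
  "cdot x y = (\<Sum>i\<in>UNIV. cnj (x $ i) * y $ i)"

lemma cdot_add_left: "cdot (x + y) z = cdot x z + cdot y z"
  and cdot_add_right: "cdot z (x + y) = cdot z x + cdot z y"
  and cdot_diff_left: "cdot (x - y) z = cdot x z - cdot y z"
  and cdot_diff_right: "cdot z (x - y) = cdot z x - cdot z y"
  by (simp_all add: cdot_def algebra_simps sum.distrib sum_subtractf)

lemma cdot_scale_left: "cdot (c *s x) y = cnj c * cdot x y"
  and cdot_scale_right: "cdot x (c *s y) = c * cdot x y"
  by (simp_all add: cdot_def sum_distrib_left algebra_simps)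

lemmas cdot_simps = cdot_add_left cdot_add_right cdot_diff_left cdot_diff_right
  cdot_scale_left cdot_scale_right

lemma cdot_0_right: "cdot x 0 = 0"
  by (simp add: cdot_def)

lemma cnj_cdot: "cnj (cdot x y) = cdot y x"
  by (simp add: cdot_def mult.commute)

lemma cdot_axis: "cdot (axis i 1) y = y $ i"
proof -
  have "cdot (axis i 1) y = (\<Sum>k\<in>UNIV. if k = i then y $ k else 0)"
    unfolding cdot_def by (rule sum.cong) (auto simp: axis_def)
  then show ?thesis by simp
qed

lemma cdot_self: "cdot x x = complex_of_real ((norm x)\<^sup>2)"
  by (simp add: cdot_def norm_vec_def L2_set_def sum_nonneg complex_norm_square mult.commute
      del: of_real_power)

lemma cdot_self_eq_1: "cdot x x = 1 \<longleftrightarrow> (\<Sum>i\<in>UNIV. (cmod (x $ i))\<^sup>2) = 1"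
  unfolding cdot_self of_real_eq_1_iff norm_vec_def L2_set_def by (simp add: sum_nonneg)

lemma cdot_normalized:
  assumes "x \<noteq> 0"
  shows "cdot (complex_of_real (inverse (norm x)) *s x) (complex_of_real (inverse (norm x)) *s x) = 1"
  unfolding cdot_scale_left cdot_scale_right unfolding cdot_self
  using assms by (simp add: power2_eq_square field_simps)

definition expct :: "complex ^ 'n ^ 'n \<Rightarrow> complex ^ 'n \<Rightarrow> real" where
  "expct A x = Re (cdot x (A *v x))"

lemma expct_sums: "expct A x = Re (\<Sum>i\<in>UNIV. \<Sum>j\<in>UNIV. cnj (x $ i) * A $ i $ j * x $ j)"
  by (simp add: expct_def cdot_def matrix_vector_mult_def sum_distrib_left mult.assoc)

lemma scaleR_mat_nth: "(c *\<^sub>R A) $ i $ j = complex_of_real c * A $ i $ j"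
  by (simp add: scaleR_conv_of_real[where 'a=complex])

lemma linear_expct:
  fixes x :: "complex ^ 'n"
  shows "linear (\<lambda>A. expct A x)"
proof (rule linearI)
  fix A B :: "complex ^ 'n ^ 'n" and c :: real
  show "expct (A + B) x = expct A x + expct B x"
    by (simp add: expct_def matrix_vector_mult_add_rdistrib cdot_add_right)
  have "(c *\<^sub>R A) *v x = complex_of_real c *s (A *v x)"
    by (simp add: vec_eq_iff matrix_vector_mult_def scaleR_mat_nth sum_distrib_left mult.assoc
        del: vector_scaleR_component)
  then show "expct (c *\<^sub>R A) x = c *\<^sub>R expct A x"
    by (simp add: expct_def cdot_scale_right)
qed

lemma expct_ket_bra: "expct (ket_bra y) x = (cmod (cdot x y))\<^sup>2"
proof -
  have "(\<Sum>i\<in>UNIV. \<Sum>j\<in>UNIV. cnj (x $ i) * ket_bra y $ i $ j * x $ j) = cdot x y * cnj (cdot x y)"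
    by (subst sum.swap) (simp add: ket_bra_def cdot_def sum_product mult_ac)
  then show ?thesis
    by (simp only: expct_sums complex_norm_square[symmetric] Re_complex_of_real)
qed

definition psd :: "complex ^ 'n ^ 'n \<Rightarrow> bool" where
  "psd A \<longleftrightarrow> psd_on UNIV (\<lambda>i j. A $ i $ j)"

lemma psd_iff: "psd A \<longleftrightarrow> (\<forall>i j. A $ j $ i = cnj (A $ i $ j)) \<and> (\<forall>x. 0 \<le> expct A x)"
proof -
  have "(\<forall>v. 0 \<le> Re (\<Sum>i\<in>UNIV. \<Sum>j\<in>UNIV. cnj (v i) * A $ i $ j * v j)) \<longleftrightarrow> (\<forall>x. 0 \<le> expct A x)"
    unfolding expct_sums by (metis (no_types, lifting) UNIV_I vec_lambda_beta sum.cong)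
  then show ?thesis by (simp add: psd_def psd_on_def)
qed

lemma ket_bra_hermitian: "ket_bra x $ j $ i = cnj (ket_bra x $ i $ j)"
  by (simp add: ket_bra_def mult.commute)

lemma psd_ket_bra: "psd (ket_bra x)"
  unfolding psd_iff expct_ket_bra using ket_bra_hermitian by auto

lemma psd_add:
  assumes "psd A" "psd B"
  shows "psd (A + B)"
  unfolding psd_iff
proof (intro conjI allI)
  show "(A + B) $ j $ i = cnj ((A + B) $ i $ j)" for i j
    using assms unfolding psd_iff by (metis complex_cnj_add vector_add_component)
  show "0 \<le> expct (A + B) x" for x
    using assms by (simp add: psd_iff linear_add[OF linear_expct])
qed

lemma psd_scale:
  assumes "psd A" "0 \<le> c"
  shows "psd (c *\<^sub>R A)"
  unfolding psd_iff
proof (intro conjI allI)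
  show "(c *\<^sub>R A) $ j $ i = cnj ((c *\<^sub>R A) $ i $ j)" for i j
    using assms(1) unfolding psd_iff by (metis complex_cnj_scaleR vector_scaleR_component)
  show "0 \<le> expct (c *\<^sub>R A) x" for x
    using assms by (simp add: psd_iff linear_scale[OF linear_expct])
qed

lemma trace_ket_bra: "trace (ket_bra x) = cdot x x"
  by (simp add: trace_def ket_bra_def cdot_def mult.commute)

lemma cdot_hermitian:
  assumes "\<And>i j. A $ j $ i = cnj (A $ i $ j)"
  shows "cdot (A *v x) y = cdot x (A *v y)"
proof -
  have "cdot (A *v x) y = (\<Sum>i\<in>UNIV. \<Sum>j\<in>UNIV. A $ j $ i * cnj (x $ j) * y $ i)"
    unfolding cdot_def matrix_vector_mult_def
    by (simp add: sum_distrib_right cnj_sum assms[symmetric])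
  also have "\<dots> = cdot x (A *v y)"
    by (subst sum.swap) (simp add: cdot_def matrix_vector_mult_def sum_distrib_left mult_ac)
  finally show ?thesis .
qed

lemma psd_trace_0:
  assumes "psd A" "Re (trace A) = 0"
  shows "A = 0"
proof -
  have herm: "A $ j $ i = cnj (A $ i $ j)" and pos: "0 \<le> expct A x" for i j x
    using assms(1) unfolding psd_iff by blast+
  have ent: "cdot (axis i 1) (A *v axis j 1) = A $ i $ j" for i j
  proof -
    have "(A *v axis j 1) $ i = (\<Sum>k\<in>UNIV. if k = j then A $ i $ k else 0)"
      unfolding matrix_vector_mult_def vec_lambda_beta by (rule sum.cong) (auto simp: axis_def)
    then show ?thesis by (simp add: cdot_axis)
  qed
  have "Re (A $ i $ i) = 0" for i
  proof -
    have "0 \<le> Re (A $ j $ j)" for j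
      using pos[of "axis j 1"] by (simp add: expct_def ent)
    then show ?thesis
      using assms(2) sum_nonneg_eq_0_iff[of UNIV "\<lambda>i. Re (A $ i $ i)"] by (simp add: trace_def)
  qed
  moreover have "Im (A $ i $ i) = 0" for i
    using arg_cong[OF herm[of i i], of Im] by simp
  ultimately have diag: "A $ i $ i = 0" for i
    by (simp add: complex_eq_iff)
  have "A $ i $ j = 0" for i j
  proof -
    \<comment> \<open>With a zero diagonal only the cross terms survive. The coefficient
      \<open>- cnj (A $ i $ j)\<close> aligns their phases, so both contribute minus the squared
      modulus of the entry.\<close>
    have "0 \<le> expct A (axis i 1 + (- cnj (A $ i $ j)) *s axis j 1)" by (rule pos)
    also have "\<dots> = - 2 * Re (A $ i $ j * cnj (A $ i $ j))"
      unfolding expct_def matrix_vector_right_distrib vector_scalar_commute cdot_simps ent diag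
        herm[of i j] by simp
    also have "\<dots> = - 2 * (cmod (A $ i $ j))\<^sup>2"
      by (simp only: complex_norm_square[symmetric] Re_complex_of_real)
    finally show ?thesis by simp
  qed
  then show ?thesis by (simp add: vec_eq_iff)
qed

lemma unit_eigenvector:
  fixes A :: "complex ^ 'n ^ 'n"
  assumes "det (mat c - A) = 0"
  obtains v where "cdot v v = 1" "A *v v = c *s v"
proof -
  obtain x where x: "(mat c - A) *v x = 0" "x \<noteq> 0"
    using assms by (metis invertible_det_nz invertible_left_inverse matrix_left_invertible_ker)
  have "mat c *v x = c *s x"
    by (simp add: vec_eq_iff matrix_vector_mult_def mat_def if_distrib if_distribR sum.delta cong: if_cong)
  then have Ax: "A *v x = c *s x"
    using x(1) by (simp add: matrix_vector_mult_diff_rdistrib)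
  define v where "v = complex_of_real (inverse (norm x)) *s x"
  have "cdot v v = 1"
    unfolding v_def using x(2) by (rule cdot_normalized)
  moreover have "A *v v = c *s v"
    by (simp add: v_def vector_scalar_commute Ax vector_smult_assoc mult.commute)
  ultimately show thesis by (rule that)
qed

text \<open>Eigenvectors of a Hermitian matrix for distinct eigenvalues are orthogonal. The
  remainder \<open>R\<close> is the compression of \<open>A\<close> to the complement of
  \<open>v\<close> and \<open>w\<close>, hence positive; since \<open>l\<close> and
  \<open>1 - l\<close> already exhaust the trace, it has trace 0 and vanishes.\<close>

lemma rank_two_spectral_decomposition:
  fixes A :: "complex ^ 'n ^ 'n" and l :: real
  assumes "psd A" "trace A = 1" "l \<noteq> 1 - l"
    and "det (mat (complex_of_real l) - A) = 0" "det (mat (complex_of_real (1 - l)) - A) = 0"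
  obtains v w where "cdot v v = 1" "cdot w w = 1" "cdot v w = 0"
    "A = l *\<^sub>R ket_bra v + (1 - l) *\<^sub>R ket_bra w"
proof -
  have herm: "A $ j $ i = cnj (A $ i $ j)" and pos: "0 \<le> expct A x" for i j x
    using assms(1) unfolding psd_iff by blast+
  note self_adj = cdot_hermitian[OF herm]
  obtain v where v: "cdot v v = 1" "A *v v = complex_of_real l *s v"
    using unit_eigenvector[OF assms(4)] .
  obtain w where w: "cdot w w = 1" "A *v w = complex_of_real (1 - l) *s w"
    using unit_eigenvector[OF assms(5)] .
  have "complex_of_real l * cdot v w = complex_of_real (1 - l) * cdot v w"
    using self_adj[of v w] by (simp add: v w cdot_simps)
  then have vw: "cdot v w = 0"
    using assms(3) by (metis mult_right_cancel of_real_eq_iff)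
  then have wv: "cdot w v = 0"
    by (metis cnj_cdot complex_cnj_zero)
  define R where "R = A - (l *\<^sub>R ket_bra v + (1 - l) *\<^sub>R ket_bra w)"
  have "0 \<le> expct R y" for y
  proof -
    define a where "a = cdot v y"
    define b where "b = cdot w y"
    \<comment> \<open>The component of \<open>y\<close> orthogonal to \<open>v\<close> and
      \<open>w\<close>; the computation shows \<open>expct R y = expct A y'\<close>.\<close>
    define y' where "y' = y - a *s v - b *s w"
    have *: "cdot v (A *v y) = complex_of_real l * a" "cdot w (A *v y) = complex_of_real (1 - l) * b"
      unfolding a_def b_def self_adj[symmetric] v w cdot_simps by simp_all
    have **: "cdot y v = cnj a" "cdot y w = cnj b"
      unfolding a_def b_def by (simp_all add: cnj_cdot)
    have "A *v y' = A *v y - (a * complex_of_real l) *s v - (b * complex_of_real (1 - l)) *s w"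
      by (simp only: y'_def matrix_vector_mult_diff_distrib vector_scalar_commute v w vector_smult_assoc)
    then have "cdot y' (A *v y') = cdot y (A *v y) - complex_of_real l * (a * cnj a)
        - complex_of_real (1 - l) * (b * cnj b)"
      unfolding y'_def by (simp add: cdot_simps * ** v w vw wv)
    also have "\<dots> = cdot y (A *v y) - complex_of_real (l * (cmod a)\<^sup>2) - complex_of_real ((1 - l) * (cmod b)\<^sup>2)"
      by (simp add: complex_norm_square del: of_real_power)
    finally have "expct A y' = expct A y - l * (cmod a)\<^sup>2 - (1 - l) * (cmod b)\<^sup>2"
      unfolding expct_def by (simp del: of_real_mult of_real_power)
    also have "\<dots> = expct R y"
      unfolding R_def linear_diff[OF linear_expct] linear_add[OF linear_expct] linear_scale[OF linear_expct]
        expct_ket_bra by (simp add: ** )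
    finally show ?thesis using pos by metis
  qed
  moreover have "R $ j $ i = cnj (R $ i $ j)" for i j
    by (simp add: R_def ket_bra_def herm[of i j] mult.commute)
  ultimately have "psd R" unfolding psd_iff by blast
  moreover have "trace R = 0"
  proof -
    have "trace R = trace A - of_real l * trace (ket_bra v) - of_real (1 - l) * trace (ket_bra w)"
      by (simp add: R_def trace_def sum.distrib sum_subtractf sum_distrib_left scaleR_conv_of_real[where 'a=complex])
    then show ?thesis by (simp add: trace_ket_bra v w assms(2))
  qed
  ultimately have "R = 0" by (simp add: psd_trace_0)
  then show thesis using that v(1) w(1) vw by (simp add: R_def)
qed

lemma ket_bra_scale: "ket_bra (c *s x) = (cmod c)\<^sup>2 *\<^sub>R ket_bra x"
  by (simp add: vec_eq_iff ket_bra_def scaleR_mat_nth complex_norm_square mult_ac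
      del: vector_scaleR_component of_real_power)

section \<open>Positive functionals and channels\<close>

text \<open>Rank-one operators generate the cone of positive matrices, so testing on them is enough.
  The notion covers Bell fidelities after a channel, overlaps with a fixed vector, and the
  complementary functional \<open>G\<close> used further below.\<close>

definition positive_functional :: "(complex ^ 'n ^ 'n \<Rightarrow> real) \<Rightarrow> bool" where
  "positive_functional L \<longleftrightarrow> linear L \<and> (\<forall>x. 0 \<le> L (ket_bra x))"

lemma positive_functional_scale:
  assumes "positive_functional L"
  shows "L (ket_bra (c *s x)) = (cmod c)\<^sup>2 * L (ket_bra x)"
  using assms by (simp add: positive_functional_def ket_bra_scale linear_scale)

lemma positive_functional_parallelogram:
  assumes "positive_functional L"
  shows "L (ket_bra (x + y)) + L (ket_bra (x - y)) = 2 * L (ket_bra x) + 2 * L (ket_bra y)"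
proof -
  have "ket_bra (x + y) + ket_bra (x - y) = 2 *\<^sub>R ket_bra x + 2 *\<^sub>R ket_bra y"
    by (simp add: vec_eq_iff ket_bra_def algebra_simps scaleR_mat_nth del: vector_scaleR_component)
  then have "L (ket_bra (x + y) + ket_bra (x - y)) = L (2 *\<^sub>R ket_bra x + 2 *\<^sub>R ket_bra y)"
    by (rule arg_cong)
  then show ?thesis
    using assms by (simp add: positive_functional_def linear_add linear_scale)
qed

text \<open>Along \<open>t x + y\<close> with real \<open>t\<close> the quadratic term is gone, so
  the value is affine in \<open>t\<close>. It is nonnegative for all \<open>t\<close>, so its slope
  is 0. This plays the role of a Cauchy-Schwarz inequality.\<close>

lemma positive_functional_null:
  assumes "positive_functional L" and null: "L (ket_bra x) = 0"
  shows "L (ket_bra (x + y)) = L (ket_bra y)"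
proof -
  have lin: "linear L" and pos: "0 \<le> L (ket_bra z)" for z
    using assms(1) by (auto simp: positive_functional_def)
  define C where "C = ket_bra (x + y) - ket_bra x - ket_bra y"
  have "ket_bra (complex_of_real t *s x + y) = t\<^sup>2 *\<^sub>R ket_bra x + ket_bra y + t *\<^sub>R C" for t
    unfolding C_def by (simp add: vec_eq_iff ket_bra_def scaleR_mat_nth algebra_simps power2_eq_square
        del: vector_scaleR_component)
  then have "L (ket_bra (complex_of_real t *s x + y)) = L (ket_bra y) + t * L C" for t
    by (simp add: linear_add[OF lin] linear_scale[OF lin] null)
  then have nonneg: "0 \<le> L (ket_bra y) + t * L C" for t
    by (metis pos)
  have "L C = 0"
  proof (rule ccontr)
    assume "L C \<noteq> 0"
    then have "L (ket_bra y) + (- (L (ket_bra y) + 1) / L C) * L C = - 1" by simp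
    with nonneg[of "- (L (ket_bra y) + 1) / L C"] show False by linarith
  qed
  then show ?thesis
    by (simp add: C_def linear_diff[OF lin] null)
qed

text \<open>Identifies the case \<open>k = 1\<close> of complete positivity with plain positivity:
  of a vector indexed by pairs, only the slice at 0 enters the sums.\<close>

lemma psd_ampliation_1:
  fixes X :: "complex ^ 'a ^ 'a"
  shows
  "psd_on ({..<1::nat} \<times> UNIV) (\<lambda>(i, a) (j, b). X $ a $ b) \<longleftrightarrow> psd X"
proof -
  have "sum f ({..<1::nat} \<times> UNIV) = (\<Sum>a\<in>UNIV. f (0, a))" for f :: "nat \<times> 'a \<Rightarrow> complex"
    by (rule sum.reindex_bij_witness[of _ "\<lambda>a. (0, a)" snd]) auto
  then have "(\<Sum>i\<in>{..<1::nat} \<times> UNIV. \<Sum>j\<in>{..<1} \<times> UNIV.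
      cnj (v i) * (case i of (i, a) \<Rightarrow> \<lambda>(j, b). X $ a $ b) j * v j) =
     (\<Sum>a\<in>UNIV. \<Sum>b\<in>UNIV. cnj (v (0, a)) * X $ a $ b * v (0, b))" for v
    by simp
  moreover have "(\<forall>v :: nat \<times> 'a \<Rightarrow> complex. P (\<lambda>a. v (0, a))) \<longleftrightarrow> (\<forall>v. P v)" for P
  proof safe
    fix v assume "\<forall>v :: nat \<times> 'a \<Rightarrow> complex. P (\<lambda>a. v (0, a))"
    from this[rule_format, of "\<lambda>(i, a). v a"] show "P v" by simp
  qed simp
  note this[of "\<lambda>v. 0 \<le> Re (\<Sum>a\<in>UNIV. \<Sum>b\<in>UNIV. cnj (v a) * X $ a $ b * v b)"]
  ultimately show ?thesis
    unfolding psd_def psd_on_def by (simp add: lessThan_Suc)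
qed

lemma cptp_linear:
  assumes "cptp \<Lambda>"
  shows "linear \<Lambda>"
proof -
  have "Vector_Spaces.linear cscale cscale \<Lambda>"
    using assms by (simp add: cptp_def)
  then have hom: "module_hom cscale cscale \<Lambda>"
    by (simp add: Vector_Spaces.linear_def)
  have "r *\<^sub>R X = cscale (complex_of_real r) X" for r X
    by (simp add: cscale_def vec_eq_iff scaleR_mat_nth del: vector_scaleR_component)
  then show ?thesis
    by (intro linearI) (simp_all add: module_hom.add[OF hom] module_hom.scale[OF hom])
qed

lemma cptp_psd:
  assumes "cptp \<Lambda>" "psd X"
  shows "psd (\<Lambda> X)"
proof -
  have "completely_positive \<Lambda>"
    using assms(1) by (simp add: cptp_def)
  from this[unfolded completely_positive_def, rule_format, of 1 "\<lambda>_ _. X"] show ?thesis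
    using assms(2) unfolding psd_ampliation_1 by blast
qed

lemma cptp_trace: "cptp \<Lambda> \<Longrightarrow> trace (\<Lambda> X) = trace X"
  by (simp add: cptp_def)

lemma positive_functional_expct_cptp:
  assumes "cptp \<Lambda>"
  shows "positive_functional (\<lambda>X. expct (\<Lambda> X) e)"
  unfolding positive_functional_def
proof
  show "linear (\<lambda>X. expct (\<Lambda> X) e)"
    using linear_compose[OF cptp_linear[OF assms] linear_expct] by (simp add: o_def)
  show "\<forall>x. 0 \<le> expct (\<Lambda> (ket_bra x)) e"
    using cptp_psd[OF assms psd_ket_bra] by (simp add: psd_iff)
qed

section \<open>Two-qubit vectors\<close>

lemma UNIV_2x2: "(UNIV :: (2 \<times> 2) set) = {(1, 1), (1, 2), (2, 1), (2, 2)}"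
  unfolding UNIV_Times_UNIV[symmetric] UNIV_2 by auto

lemma sum_2x2: "(\<Sum>i\<in>(UNIV :: (2 \<times> 2) set). f i) = f (1, 1) + f (1, 2) + f (2, 1) + f (2, 2)"
  unfolding UNIV_2x2 by (simp add: add.assoc)

lemma forall_2x2: "(\<forall>i :: 2 \<times> 2. P i) \<longleftrightarrow> P (1, 1) \<and> P (1, 2) \<and> P (2, 1) \<and> P (2, 2)"
  unfolding split_paired_All forall_2 by auto

definition tensor :: "complex ^ 2 \<Rightarrow> complex ^ 2 \<Rightarrow> complex ^ (2 \<times> 2)" where
  "tensor a b = (\<chi> i. a $ fst i * b $ snd i)"

lemma kron_ket_bra: "kron (ket_bra a) (ket_bra b) = ket_bra (tensor a b)"
  by (simp add: vec_eq_iff kron_def ket_bra_def tensor_def mult_ac)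

lemma cdot_tensor: "cdot (tensor a b) (tensor c d) = cdot a c * cdot b d"
  by (simp add: cdot_def tensor_def sum_2x2 sum_2 algebra_simps)

lemma tensor_scale_left: "tensor (c *s a) b = c *s tensor a b"
  and tensor_scale_right: "tensor a (c *s b) = c *s tensor a b"
  and tensor_add_left: "tensor (a + a') b = tensor a b + tensor a' b"
  and tensor_add_right: "tensor a (b + b') = tensor a b + tensor a b'"
  by (simp_all add: vec_eq_iff tensor_def algebra_simps)

text \<open>The determinant of the 2 by 2 coefficient matrix of the vector. It vanishes iff that
  matrix has rank at most 1, that is, on product vectors.\<close>

definition two_qubit_det :: "complex ^ (2 \<times> 2) \<Rightarrow> complex" where
  "two_qubit_det x = x $ (1, 1) * x $ (2, 2) - x $ (1, 2) * x $ (2, 1)"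

lemma tensor_of_two_qubit_det_0:
  assumes "two_qubit_det x = 0"
  obtains a b where "x = tensor a b"
proof (cases "x $ (1, 1) = 0 \<and> x $ (1, 2) = 0")
  case True
  have "x = tensor (vector [0, 1]) (vector [x $ (2, 1), x $ (2, 2)])"
    unfolding vec_eq_iff forall_2x2 using True by (simp add: tensor_def)
  then show thesis by (rule that)
next
  case False
  \<comment> \<open>The second row is \<open>k\<close> times the first; the ratio is read off in a
    column where the first row is nonzero.\<close>
  define k where "k = (if x $ (1, 1) = 0 then x $ (2, 2) / x $ (1, 2) else x $ (2, 1) / x $ (1, 1))"
  have "x = tensor (vector [1, k]) (vector [x $ (1, 1), x $ (1, 2)])"
    unfolding vec_eq_iff forall_2x2 using False assms
    by (auto simp: tensor_def k_def two_qubit_det_def field_simps)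
  then show thesis by (rule that)
qed

lemma unit_product_vector:
  assumes "x \<noteq> 0" "two_qubit_det x = 0"
  obtains c a b where "c *s x = tensor a b" "cdot a a = 1" "cdot b b = 1"
proof -
  obtain a b where ab: "x = tensor a b"
    using tensor_of_two_qubit_det_0[OF assms(2)] .
  have nz: "a \<noteq> 0" "b \<noteq> 0"
    using assms(1) by (auto simp: ab tensor_def vec_eq_iff)
  show thesis
    by (rule that[of "complex_of_real (inverse (norm a)) * complex_of_real (inverse (norm b))",
          OF _ cdot_normalized[OF nz(1)] cdot_normalized[OF nz(2)]])
      (simp add: tensor_scale_left tensor_scale_right ab vector_smult_assoc mult.commute)
qed

lemma quadratic_root:
  fixes a b c :: complex
  assumes "a \<noteq> 0"
  shows "\<exists>z. a * z\<^sup>2 + b * z + c = 0"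
proof -
  define z where "z = (csqrt (b\<^sup>2 - 4 * a * c) - b) / (2 * a)"
  have "2 * a * z + b = csqrt (b\<^sup>2 - 4 * a * c)"
    using assms by (simp add: z_def)
  then have "(2 * a * z + b)\<^sup>2 = b\<^sup>2 - 4 * a * c" by simp
  then have "4 * a * (a * z\<^sup>2 + b * z + c) = 0"
    by (simp add: power2_eq_square algebra_simps)
  then show ?thesis using assms by auto
qed

text \<open>The determinant restricts to a binary quadratic form on the plane, which has a nontrivial zero.\<close>

lemma plane_contains_product_vector:
  assumes "cdot v v = 1" "cdot w w = 1" "cdot v w = 0"
  obtains \<alpha> \<beta> a b where "tensor a b = \<alpha> *s v + \<beta> *s w" "cdot a a = 1" "cdot b b = 1"
proof (cases "two_qubit_det w = 0")
  case True
  moreover have "w \<noteq> 0" using assms(2) by (auto simp: cdot_def)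
  ultimately show thesis
    using unit_product_vector[of w] that[of _ _ 0] by (metis vector_smult_lzero add_0)
next
  case False
  \<comment> \<open>The left side is the expansion of \<open>two_qubit_det (v + z *s w)\<close> in
    powers of \<open>z\<close>.\<close>
  obtain z where z: "two_qubit_det w * z\<^sup>2 + (v $ (1, 1) * w $ (2, 2) + w $ (1, 1) * v $ (2, 2)
      - v $ (1, 2) * w $ (2, 1) - w $ (1, 2) * v $ (2, 1)) * z + two_qubit_det v = 0"
    using quadratic_root[OF False] by blast
  have "two_qubit_det (v + z *s w) = 0"
    using z by (simp add: two_qubit_det_def power2_eq_square algebra_simps)
  moreover have "cdot v (v + z *s w) \<noteq> 0"
    using assms by (simp add: cdot_simps)
  then have "v + z *s w \<noteq> 0" by (metis cdot_0_right)
  ultimately obtain c a b where "c *s (v + z *s w) = tensor a b" "cdot a a = 1" "cdot b b = 1"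
    using unit_product_vector by metis
  then show thesis
    using that[of a b c "c * z"] by (simp add: vector_add_ldistrib vector_smult_assoc)
qed

text \<open>Completes a unit vector \<open>a\<close> to an orthonormal basis of the qubit
  space.\<close>

definition orth :: "complex ^ 2 \<Rightarrow> complex ^ 2" where
  "orth a = vector [- cnj (a $ 2), cnj (a $ 1)]"

lemma cdot_orth: "cdot a (orth a) = 0" "cdot (orth a) a = 0" "cdot (orth a) (orth a) = cdot a a"
  by (simp_all add: cdot_def orth_def sum_2 mult.commute)

lemma tensor_resolution:
  assumes "cdot a a = 1" "cdot b b = 1"
  shows "x = cdot (tensor a b) x *s tensor a b + cdot (tensor a (orth b)) x *s tensor a (orth b)
    + cdot (tensor (orth a) b) x *s tensor (orth a) b
    + cdot (tensor (orth a) (orth b)) x *s tensor (orth a) (orth b)"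
proof -
  \<comment> \<open>A polynomial identity for arbitrary \<open>a\<close> and \<open>b\<close>;
    normalization is applied only afterwards.\<close>
  have "cdot (tensor a b) x *s tensor a b + cdot (tensor a (orth b)) x *s tensor a (orth b)
    + cdot (tensor (orth a) b) x *s tensor (orth a) b
    + cdot (tensor (orth a) (orth b)) x *s tensor (orth a) (orth b) = (cdot a a * cdot b b) *s x"
    unfolding vec_eq_iff forall_2x2 by (simp add: cdot_def orth_def tensor_def sum_2 sum_2x2 algebra_simps)
  then show ?thesis by (simp add: assms)
qed

text \<open>Such a matrix is block diagonal: a 2 by 2 block on the indices (1,1) and (2,2), and two
  1 by 1 blocks. It gives the characteristic polynomials of both targets.\<close>

lemma det_bell_block:
  fixes A :: "complex ^ (2 \<times> 2) ^ (2 \<times> 2)"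
  assumes "\<And>i j. i \<noteq> j \<Longrightarrow> fst i \<noteq> snd i \<or> fst j \<noteq> snd j \<Longrightarrow> A $ i $ j = 0"
  shows "det A = (A $ (1, 1) $ (1, 1) * A $ (2, 2) $ (2, 2) - A $ (1, 1) $ (2, 2) * A $ (2, 2) $ (1, 1))
    * A $ (1, 2) $ (1, 2) * A $ (2, 1) $ (2, 1)"
proof -
  have f: "finite {(1, 2), (2, 1), (2 :: 2, 2 :: 2)}" "(1, 1) \<notin> {(1, 2), (2, 1), (2 :: 2, 2 :: 2)}"
    "finite {(2, 1), (2 :: 2, 2 :: 2)}" "(1, 2) \<notin> {(2, 1), (2 :: 2, 2 :: 2)}"
    "finite {(2 :: 2, 2 :: 2)}" "(2, 1) \<notin> {(2 :: 2, 2 :: 2)}"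
    by auto
  have z: "A $ (1, 1) $ (1, 2) = 0" "A $ (1, 1) $ (2, 1) = 0" "A $ (1, 2) $ (1, 1) = 0"
    "A $ (1, 2) $ (2, 1) = 0" "A $ (1, 2) $ (2, 2) = 0" "A $ (2, 1) $ (1, 1) = 0"
    "A $ (2, 1) $ (1, 2) = 0" "A $ (2, 1) $ (2, 2) = 0" "A $ (2, 2) $ (1, 2) = 0" "A $ (2, 2) $ (2, 1) = 0"
    by (simp_all add: assms)
  show ?thesis
    unfolding det_def UNIV_2x2
    unfolding sum_over_permutations_insert[OF f(1,2)]
    unfolding sum_over_permutations_insert[OF f(3,4)]
    unfolding sum_over_permutations_insert[OF f(5,6)]
    unfolding permutes_sing
    by (simp add: sign_swap_id permutation_swap_id sign_compose sign_id swap_id_eq z algebra_simps)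
qed

section \<open>Separable states and the Bell state\<close>

text \<open>For \<open>s = 1\<close> and \<open>s = - 1\<close> these are the two Bell states scaled
  to squared norm 2, which avoids square roots and explains the factors 1/2 in the targets.\<close>

definition bell :: "complex \<Rightarrow> complex ^ (2 \<times> 2)" where
  "bell s = (\<chi> i. if i = (1, 1) then 1 else if i = (2, 2) then s else 0)"

definition e12 :: "complex ^ (2 \<times> 2)" where
  "e12 = (\<chi> i. if i = (1, 2) then 1 else 0)"

definition e21 :: "complex ^ (2 \<times> 2)" where
  "e21 = (\<chi> i. if i = (2, 1) then 1 else 0)"

lemma cdot_bell: "cdot (bell s) x = x $ (1, 1) + cnj s * x $ (2, 2)"
  and cdot_e12: "cdot e12 x = x $ (1, 2)"
  and cdot_e21: "cdot e21 x = x $ (2, 1)"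
  by (simp_all add: cdot_def bell_def e12_def e21_def sum_2x2)

lemma bell_nth: "bell s $ (1, 1) = 1" "bell s $ (1, 2) = 0" "bell s $ (2, 1) = 0" "bell s $ (2, 2) = s"
  and e12_nth: "e12 $ (1, 1) = 0" "e12 $ (1, 2) = 1" "e12 $ (2, 1) = 0" "e12 $ (2, 2) = 0"
  by (simp_all add: bell_def e12_def)

text \<open>The expectation is twice the fidelity with the Bell state, as \<^term>\<open>bell 1\<close> is not normalized.\<close>

lemma expct_bell_le_trace:
  assumes "psd A"
  shows "expct A (bell 1) \<le> 2 * Re (trace A)"
proof -
  have pos: "0 \<le> expct A x" for x using assms by (simp add: psd_iff)
  \<comment> \<open>The four vectors form an orthogonal basis; \<open>e12\<close> and
    \<open>e21\<close> are counted twice because the Bell vectors have squared norm 2.\<close>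
  have "expct A (bell 1) + expct A (bell (- 1)) + 2 * expct A e12 + 2 * expct A e21 = 2 * Re (trace A)"
    unfolding expct_def cdot_bell cdot_e12 cdot_e21 trace_def sum_2x2 matrix_vector_mult_def
    by (simp add: bell_def e12_def e21_def sum_2x2)
  with pos[of "bell (- 1)"] pos[of e12] pos[of e21] show ?thesis by linarith
qed

lemma separable_state_sum:
  assumes "\<tau> \<in> separable_states"
  obtains n :: nat and p :: "nat \<Rightarrow> real" and a b where
    "\<forall>i<n. 0 \<le> p i" "(\<Sum>i<n. p i) = 1"
    "\<forall>i<n. cdot (a i) (a i) = 1" "\<forall>i<n. cdot (b i) (b i) = 1"
    "\<forall>x. expct \<tau> x = (\<Sum>i<n. p i * (cmod (cdot x (tensor (a i) (b i))))\<^sup>2)"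
proof -
  obtain n :: nat and p :: "nat \<Rightarrow> real" and a b where *: "\<forall>i<n. 0 \<le> p i" "(\<Sum>i<n. p i) = 1"
    "\<forall>i<n. norm (a i) = 1 \<and> norm (b i) = 1"
    "\<tau> = (\<Sum>i<n. p i *\<^sub>R kron (ket_bra (a i)) (ket_bra (b i)))"
    using assms unfolding separable_states_def by blast
  show thesis
  proof (rule that[of n p a b])
    show "\<forall>x. expct \<tau> x = (\<Sum>i<n. p i * (cmod (cdot x (tensor (a i) (b i))))\<^sup>2)" for x
      unfolding *(4) linear_sum[OF linear_expct] linear_scale[OF linear_expct]
      by (simp add: kron_ket_bra expct_ket_bra)
  qed (use * in \<open>simp_all add: cdot_self\<close>)
qed

lemma separable_null:
  fixes p :: "nat \<Rightarrow> real"
  assumes "\<And>i. i < n \<Longrightarrow> 0 \<le> p i" "(\<Sum>i<n. p i * (cmod (z i))\<^sup>2) = 0" "i < n" "p i \<noteq> 0"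
  shows "z i = 0"
  using assms sum_nonneg_eq_0_iff[of "{..<n}" "\<lambda>i. p i * (cmod (z i))\<^sup>2"] by force

lemma bell_tensor_le:
  assumes "cdot a a = 1" "cdot b b = 1"
  shows "(cmod (cdot (bell 1) (tensor a b)))\<^sup>2 \<le> 1"
proof -
  have unit: "(cmod (x $ 1))\<^sup>2 + (cmod (x $ 2))\<^sup>2 = 1" if "cdot x x = 1" for x :: "complex ^ 2"
    using that by (simp add: cdot_self_eq_1 sum_2)
  have "(cmod (a $ 1 * b $ 1 + a $ 2 * b $ 2))\<^sup>2 \<le> (cmod (a $ 1) * cmod (b $ 1) + cmod (a $ 2) * cmod (b $ 2))\<^sup>2"
    by (intro power_mono) (auto intro: norm_triangle_le simp: norm_mult)
  also have "\<dots> \<le> ((cmod (a $ 1))\<^sup>2 + (cmod (a $ 2))\<^sup>2) * ((cmod (b $ 1))\<^sup>2 + (cmod (b $ 2))\<^sup>2)"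
    \<comment> \<open>The difference of the two sides is this square (Lagrange's identity).\<close>
    using zero_le_power2[of "cmod (a $ 1) * cmod (b $ 2) - cmod (a $ 2) * cmod (b $ 1)"]
    by (simp add: power2_eq_square algebra_simps)
  finally show ?thesis by (simp add: cdot_bell tensor_def unit[OF assms(1)] unit[OF assms(2)])
qed

lemma expct_bell_separable_le:
  assumes "\<tau> \<in> separable_states"
  shows "expct \<tau> (bell 1) \<le> 1"
proof -
  obtain n :: nat and p :: "nat \<Rightarrow> real" and a b where
    sep: "\<forall>i<n. 0 \<le> p i" "(\<Sum>i<n. p i) = 1"
    "\<forall>i<n. cdot (a i) (a i) = 1" "\<forall>i<n. cdot (b i) (b i) = 1"
    "\<forall>x. expct \<tau> x = (\<Sum>i<n. p i * (cmod (cdot x (tensor (a i) (b i))))\<^sup>2)"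
    using separable_state_sum[OF assms] .
  have "expct \<tau> (bell 1) \<le> (\<Sum>i<n. p i * 1)"
    unfolding sep(5)[rule_format] by (intro sum_mono mult_left_mono bell_tensor_le) (use sep in auto)
  then show ?thesis using sep(2) by simp
qed

text \<open>Each product vector \<open>x\<close> of positive weight has
  \<open>x $ (2, 1) = 0\<close> and equal components at (1,1) and (2,2). Their product is 0 by the
  rank condition, so both vanish and the overlap with \<open>bell 1\<close> is 0.\<close>

lemma expct_bell_separable_0:
  assumes "\<tau> \<in> separable_states" "expct \<tau> e21 = 0" "expct \<tau> (bell (- 1)) = 0"
  shows "expct \<tau> (bell 1) = 0"
proof -
  obtain n :: nat and p :: "nat \<Rightarrow> real" and a b where
    sep: "\<forall>i<n. 0 \<le> p i" "(\<Sum>i<n. p i) = 1"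
    "\<forall>i<n. cdot (a i) (a i) = 1" "\<forall>i<n. cdot (b i) (b i) = 1"
    "\<forall>x. expct \<tau> x = (\<Sum>i<n. p i * (cmod (cdot x (tensor (a i) (b i))))\<^sup>2)"
    using separable_state_sum[OF assms(1)] .
  have "p i * (cmod (cdot (bell 1) (tensor (a i) (b i))))\<^sup>2 = 0" if i: "i < n" for i
  proof (cases "p i = 0")
    case False
    have "a i $ 2 * b i $ 1 = 0" "a i $ 1 * b i $ 1 - a i $ 2 * b i $ 2 = 0"
      using separable_null[OF sep(1)[rule_format] assms(2)[unfolded sep(5)[rule_format]] i False]
        separable_null[OF sep(1)[rule_format] assms(3)[unfolded sep(5)[rule_format]] i False]
      by (simp_all add: cdot_e21 cdot_bell tensor_def)
    then show ?thesis by (auto simp: cdot_bell tensor_def)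
  qed simp
  then have "(\<Sum>i<n. p i * (cmod (cdot (bell 1) (tensor (a i) (b i))))\<^sup>2) = (\<Sum>i<n. 0)"
    by (intro sum.cong) auto
  then show ?thesis unfolding sep(5)[rule_format] by simp
qed

text \<open>Each product vector of positive weight lies in the span of the basis vectors (1,1) and
  (2,2). The rank condition leaves only one of them, with a phase, so its overlap with
  \<open>bell 1\<close> has modulus 1.\<close>

lemma expct_bell_separable_1:
  assumes "\<tau> \<in> separable_states" "expct \<tau> e21 = 0" "expct \<tau> e12 = 0"
  shows "expct \<tau> (bell 1) = 1"
proof -
  obtain n :: nat and p :: "nat \<Rightarrow> real" and a b where
    sep: "\<forall>i<n. 0 \<le> p i" "(\<Sum>i<n. p i) = 1"
    "\<forall>i<n. cdot (a i) (a i) = 1" "\<forall>i<n. cdot (b i) (b i) = 1"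
    "\<forall>x. expct \<tau> x = (\<Sum>i<n. p i * (cmod (cdot x (tensor (a i) (b i))))\<^sup>2)"
    using separable_state_sum[OF assms(1)] .
  have "p i * (cmod (cdot (bell 1) (tensor (a i) (b i))))\<^sup>2 = p i" if i: "i < n" for i
  proof (cases "p i = 0")
    case False
    define x where "x = tensor (a i) (b i)"
    have "x $ (2, 1) = 0" "x $ (1, 2) = 0"
      using separable_null[OF sep(1)[rule_format] assms(2)[unfolded sep(5)[rule_format]] i False]
        separable_null[OF sep(1)[rule_format] assms(3)[unfolded sep(5)[rule_format]] i False]
      by (simp_all add: cdot_e21 cdot_e12 x_def)
    moreover from this have "x $ (1, 1) = 0 \<or> x $ (2, 2) = 0"
      by (auto simp: x_def tensor_def)
    moreover have "(cmod (x $ (1, 1)))\<^sup>2 + (cmod (x $ (1, 2)))\<^sup>2 + (cmod (x $ (2, 1)))\<^sup>2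
        + (cmod (x $ (2, 2)))\<^sup>2 = 1"
      using sep(3,4) i cdot_self_eq_1[of x] by (simp add: x_def cdot_tensor sum_2x2)
    ultimately have "(cmod (cdot (bell 1) x))\<^sup>2 = 1"
      by (auto simp: cdot_bell)
    then show ?thesis by (simp add: x_def)
  qed simp
  then have "(\<Sum>i<n. p i * (cmod (cdot (bell 1) (tensor (a i) (b i))))\<^sup>2) = (\<Sum>i<n. p i)"
    by (intro sum.cong) auto
  then show ?thesis unfolding sep(5)[rule_format] using sep(2) by simp
qed

lemma ket_bra_tensor_separable:
  assumes "cdot a a = 1" "cdot b b = 1"
  shows "ket_bra (tensor a b) \<in> separable_states"
proof -
  have "norm a = 1" "norm b = 1"
    using assms unfolding cdot_self of_real_eq_1_iff by (simp_all add: abs_square_eq_1)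
  moreover have "ket_bra (tensor a b) \<in> two_qubit_states"
    using psd_ket_bra[of "tensor a b"] assms
    by (simp add: two_qubit_states_def psd_def trace_ket_bra cdot_tensor)
  moreover have "\<exists>(n::nat) (p :: nat \<Rightarrow> real) (\<psi> :: nat \<Rightarrow> complex ^ 2) (\<phi> :: nat \<Rightarrow> complex ^ 2).
      (\<forall>i<n. 0 \<le> p i) \<and> (\<Sum>i<n. p i) = 1 \<and> (\<forall>i<n. norm (\<psi> i) = 1 \<and> norm (\<phi> i) = 1) \<and>
      ket_bra (tensor a b) = (\<Sum>i<n. p i *\<^sub>R kron (ket_bra (\<psi> i)) (ket_bra (\<phi> i)))"
    by (rule exI[of _ 1], rule exI[of _ "\<lambda>_. 1"], rule exI[of _ "\<lambda>_. a"], rule exI[of _ "\<lambda>_. b"])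
      (simp add: kron_ket_bra \<open>norm a = 1\<close> \<open>norm b = 1\<close>)
  ultimately show ?thesis by (simp add: separable_states_def)
qed

text \<open>Treats both targets at once: \<open>m\<close> is the second eigenvalue divided by the
  squared norm of \<open>x\<close>. The bound \<open>1 / 2 \<le> l\<close> puts the spectrum in
  order.\<close>

lemma isospectral_state:
  fixes l m :: real and x :: "complex ^ (2 \<times> 2)"
  assumes l: "1 / 2 \<le> l" "l \<le> 1"
    and x: "x = e12 \<and> m = 1 - l \<or> x = bell (- 1) \<and> m = (1 - l) / 2"
  defines "\<sigma> \<equiv> (l / 2) *\<^sub>R ket_bra (bell 1) + m *\<^sub>R ket_bra x"
  shows "\<sigma> \<in> two_qubit_states \<and> has_spectrum \<sigma> [l, 1 - l, 0, 0]"
proof -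
  have "psd \<sigma>"
    unfolding \<sigma>_def using l x by (intro psd_add psd_scale psd_ket_bra) auto
  moreover have entry: "\<sigma> $ i $ j = complex_of_real (l / 2) * (bell 1 $ i * cnj (bell 1 $ j))
      + complex_of_real m * (x $ i * cnj (x $ j))" for i j
    by (simp add: \<sigma>_def scaleR_mat_nth ket_bra_def del: vector_scaleR_component)
  have "trace \<sigma> = 1"
    using x unfolding trace_def sum_2x2 entry
    by (elim disjE conjE; hypsubst) (simp_all add: bell_def e12_def field_simps)
  moreover have "det (mat z - \<sigma>) = (z - complex_of_real l) * ((z - complex_of_real (1 - l)) * (z * z))" for z
  proof (subst det_bell_block)
    show "(mat z - \<sigma>) $ i $ j = 0" if "i \<noteq> j" "fst i \<noteq> snd i \<or> fst j \<noteq> snd j" for i j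
    proof -
      have *: "bell s $ i * cnj (bell s $ j) = 0" "e12 $ i * cnj (e12 $ j) = 0" for s
        using that by (auto simp: bell_def e12_def)
      have "\<sigma> $ i $ j = 0"
        unfolding entry using x by (elim disjE conjE; hypsubst) (simp_all only: * mult_zero_right add_0)
      then show ?thesis using that(1) by (simp add: mat_def)
    qed
    show "((mat z - \<sigma>) $ (1, 1) $ (1, 1) * (mat z - \<sigma>) $ (2, 2) $ (2, 2) -
       (mat z - \<sigma>) $ (1, 1) $ (2, 2) * (mat z - \<sigma>) $ (2, 2) $ (1, 1)) *
      (mat z - \<sigma>) $ (1, 2) $ (1, 2) * (mat z - \<sigma>) $ (2, 1) $ (2, 1) =
      (z - complex_of_real l) * ((z - complex_of_real (1 - l)) * (z * z))"
      using x unfolding vector_minus_component entry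
      by (elim disjE conjE; hypsubst) (simp_all add: mat_def bell_def e12_def field_simps)
  qed
  ultimately show ?thesis
    using l by (simp add: two_qubit_states_def psd_def has_spectrum_def)
qed

lemma positive_functional_range_null:
  assumes L: "positive_functional L" "L (l *\<^sub>R ket_bra v + m *\<^sub>R ket_bra w) = 0" and "0 < l" "0 < m"
  shows "L (ket_bra (\<alpha> *s v + \<beta> *s w)) = 0"
proof -
  have lin: "linear L" and pos: "0 \<le> L (ket_bra x)" for x
    using L(1) by (auto simp: positive_functional_def)
  have "l * L (ket_bra v) + m * L (ket_bra w) = 0"
    using L(2) by (simp add: linear_add[OF lin] linear_scale[OF lin])
  moreover have "0 \<le> l * L (ket_bra v)" "0 \<le> m * L (ket_bra w)"
    using assms(3,4) pos by simp_all
  ultimately have "L (ket_bra v) = 0" "L (ket_bra w) = 0"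
    using assms(3,4) by (simp_all add: add_nonneg_eq_0_iff)
  then show ?thesis
    using positive_functional_null[OF L(1), of "\<alpha> *s v" "\<beta> *s w"]
    by (simp add: positive_functional_scale[OF L(1)])
qed

lemma positive_functional_product_bound:
  assumes L: "positive_functional L"
    and K: "\<And>a b. cdot a a = 1 \<Longrightarrow> cdot b b = 1 \<Longrightarrow> L (ket_bra (tensor a b)) \<le> K"
  shows "L (ket_bra (tensor c d)) \<le> K * (norm c)\<^sup>2 * (norm d)\<^sup>2"
proof (cases "c = 0 \<or> d = 0")
  case True
  then have "tensor c d = 0 *s tensor c d" by (auto simp: vec_eq_iff tensor_def)
  then have "L (ket_bra (tensor c d)) = 0"
    using positive_functional_scale[OF L, of 0 "tensor c d"] by simp
  then show ?thesis using True by auto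
next
  case False
  define c' where "c' = complex_of_real (inverse (norm c)) *s c"
  define d' where "d' = complex_of_real (inverse (norm d)) *s d"
  have "c = complex_of_real (norm c) *s c'" "d = complex_of_real (norm d) *s d'"
    using False by (simp_all add: c'_def d'_def vector_smult_assoc)
  from arg_cong2[OF this, of tensor] have "tensor c d = complex_of_real (norm c * norm d) *s tensor c' d'"
    by (simp add: tensor_scale_left tensor_scale_right vector_smult_assoc mult.commute)
  then have "L (ket_bra (tensor c d)) = (norm c * norm d)\<^sup>2 * L (ket_bra (tensor c' d'))"
    by (simp only: positive_functional_scale[OF L] norm_of_real power2_abs)
  also have "\<dots> \<le> (norm c * norm d)\<^sup>2 * K"
    using False unfolding c'_def d'_def by (intro mult_left_mono K cdot_normalized) auto
  finally show ?thesis by (simp add: power_mult_distrib mult_ac)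
qed

section \<open>Maps whose target has a Bell eigenvector\<close>

text \<open>Common setting of the two targets. Orthogonality of \<open>x\<close> to
  \<open>bell 1\<close> makes \<open>bell 1\<close> an eigenvector of the target with eigenvalue
  \<open>l\<close>.\<close>

locale bell_target =
  fixes \<Lambda> :: "two_qubit_op \<Rightarrow> two_qubit_op" and l m :: real and v w x :: "complex ^ (2 \<times> 2)"
  assumes NE: "non_entangling \<Lambda>"
    and target: "\<Lambda> (l *\<^sub>R ket_bra v + (1 - l) *\<^sub>R ket_bra w) = (l / 2) *\<^sub>R ket_bra (bell 1) + m *\<^sub>R ket_bra x"
    and orthonormal: "cdot v v = 1" "cdot w w = 1" "cdot v w = 0"
    and l: "1 / 2 < l" "l < 1"
    and x: "cdot (bell 1) x = 0"
begin

definition "L X = expct (\<Lambda> X) (bell 1)"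

lemma cptp: "cptp \<Lambda>"
  using NE by (simp add: non_entangling_def)

lemma positive: "positive_functional L"
  unfolding L_def by (rule positive_functional_expct_cptp[OF cptp])

lemma linear: "linear L" and nonneg: "0 \<le> L (ket_bra y)"
  using positive by (auto simp: positive_functional_def)

lemma le_2: "L (ket_bra y) \<le> 2 * Re (cdot y y)"
  using expct_bell_le_trace[OF cptp_psd[OF cptp psd_ket_bra]]
  by (simp add: L_def cptp_trace[OF cptp] trace_ket_bra)

lemma separable: "cdot a a = 1 \<Longrightarrow> cdot b b = 1 \<Longrightarrow> \<Lambda> (ket_bra (tensor a b)) \<in> separable_states"
  using NE ket_bra_tensor_separable by (auto simp: non_entangling_def)

lemma product_le_1: "cdot a a = 1 \<Longrightarrow> cdot b b = 1 \<Longrightarrow> L (ket_bra (tensor a b)) \<le> 1"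
  unfolding L_def by (intro expct_bell_separable_le separable)

lemma target_value: "l * L (ket_bra v) + (1 - l) * L (ket_bra w) = 2 * l"
proof -
  have "l * L (ket_bra v) + (1 - l) * L (ket_bra w) = L (l *\<^sub>R ket_bra v + (1 - l) *\<^sub>R ket_bra w)"
    by (simp add: linear_add[OF linear] linear_scale[OF linear])
  also have "\<dots> = l / 2 * (cmod (cdot (bell 1) (bell 1)))\<^sup>2"
    by (simp add: L_def target linear_add[OF linear_expct] linear_scale[OF linear_expct] expct_ket_bra x)
  also have "\<dots> = 2 * l" by (simp add: cdot_bell bell_nth)
  finally show ?thesis .
qed

text \<open>Such an \<open>e\<close> is orthogonal to the range of the target, and the image of any
  pure state from the plane is supported in that range.\<close>

lemma null:
  assumes "cdot e (bell 1) = 0" "cdot e x = 0"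
  shows "expct (\<Lambda> (ket_bra (\<alpha> *s v + \<beta> *s w))) e = 0"
  by (rule positive_functional_range_null[OF positive_functional_expct_cptp[OF cptp], where l = l and m = "1 - l"])
    (use l assms in \<open>simp_all add: target linear_add[OF linear_expct] linear_scale[OF linear_expct] expct_ket_bra\<close>)

lemma product_eigenvector:
  assumes "x = e12"
  obtains a b where "cdot a a = 1" "cdot b b = 1" "cdot v (tensor a b) = 0"
    "ket_bra w = ket_bra (tensor a b)" "L (ket_bra v) = 2"
proof -
  obtain \<alpha> \<beta> a b where ab: "tensor a b = \<alpha> *s v + \<beta> *s w" "cdot a a = 1" "cdot b b = 1"
    using plane_contains_product_vector[OF orthonormal] .
  have wv: "cdot w v = 0" using orthonormal(3) by (metis cnj_cdot complex_cnj_zero)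
  define u where "u = tensor a b"
  have L0: "L (ket_bra u) = 0"
    unfolding L_def
  proof (rule expct_bell_separable_0)
    show "\<Lambda> (ket_bra u) \<in> separable_states" unfolding u_def using ab by (intro separable)
    show "expct (\<Lambda> (ket_bra u)) e21 = 0" "expct (\<Lambda> (ket_bra u)) (bell (- 1)) = 0"
      unfolding u_def ab(1)
      by (rule null; simp add: assms cdot_e21 cdot_bell bell_nth e12_nth)+
  qed
  have uu: "cdot u u = \<alpha> * cnj \<alpha> + \<beta> * cnj \<beta>"
    unfolding u_def ab(1) by (simp add: cdot_simps orthonormal wv)
  have uu1: "cdot u u = 1" by (simp add: u_def cdot_tensor ab(2,3))
  have "complex_of_real ((cmod \<alpha>)\<^sup>2 + (cmod \<beta>)\<^sup>2) = 1"
    using uu uu1 by (simp add: complex_norm_square del: of_real_power)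
  then have norm1: "(cmod \<alpha>)\<^sup>2 + (cmod \<beta>)\<^sup>2 = 1" by (simp only: of_real_eq_1_iff)
  have c1: "\<alpha> * cnj \<alpha> + \<beta> * cnj \<beta> = 1"
    using uu uu1 by simp
  \<comment> \<open>The vector of the plane orthogonal to \<open>u\<close>. As \<open>L\<close>
    vanishes on \<open>u\<close>, its values on \<open>v\<close> and \<open>w\<close> depend only on
    their components along \<open>y\<close>.\<close>
  define y where "y = cnj \<beta> *s v - cnj \<alpha> *s w"
  have "cnj \<alpha> *s u + \<beta> *s y = (\<alpha> * cnj \<alpha> + \<beta> * cnj \<beta>) *s v"
    "cnj \<beta> *s u + (- \<alpha>) *s y = (\<alpha> * cnj \<alpha> + \<beta> * cnj \<beta>) *s w"
    unfolding u_def ab(1) y_def by (simp_all add: vec_eq_iff algebra_simps)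
  then have v: "v = cnj \<alpha> *s u + \<beta> *s y" and w: "w = cnj \<beta> *s u + (- \<alpha>) *s y"
    by (simp_all add: c1)
  have null_u: "L (ket_bra (c *s u)) = 0" for c
    by (simp add: positive_functional_scale[OF positive] L0)
  have Lv: "L (ket_bra v) = (cmod \<beta>)\<^sup>2 * L (ket_bra y)"
    by (subst v) (simp only: positive_functional_null[OF positive null_u] positive_functional_scale[OF positive])
  have Lw: "L (ket_bra w) = (cmod \<alpha>)\<^sup>2 * L (ket_bra y)"
    by (subst w) (simp only: positive_functional_null[OF positive null_u] positive_functional_scale[OF positive] norm_minus_cancel)
  have "cdot y y = \<alpha> * cnj \<alpha> + \<beta> * cnj \<beta>"
    unfolding y_def by (simp add: cdot_simps orthonormal wv)
  then have Ly: "L (ket_bra y) \<le> 2"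
    using le_2[of y] by (simp add: c1)
  have *: "(l * (cmod \<beta>)\<^sup>2 + (1 - l) * (cmod \<alpha>)\<^sup>2) * L (ket_bra y) = 2 * l"
    using target_value unfolding Lv Lw by (simp add: algebra_simps)
  \<comment> \<open>The bracket is an average of \<open>l\<close> and \<open>1 - l\<close>, and it
    must be at least \<open>l\<close>. Since \<open>l > 1 / 2\<close>, all weight sits on
    \<open>\<beta>\<close>.\<close>
  have "2 * l \<le> (l * (cmod \<beta>)\<^sup>2 + (1 - l) * (cmod \<alpha>)\<^sup>2) * 2"
    unfolding *[symmetric] using l Ly by (intro mult_left_mono) auto
  also have "(cmod \<beta>)\<^sup>2 = 1 - (cmod \<alpha>)\<^sup>2" using norm1 by simp
  finally have "(2 * l - 1) * (cmod \<alpha>)\<^sup>2 \<le> 0" by (simp add: algebra_simps)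
  then have \<alpha>: "\<alpha> = 0" using l by (simp add: mult_le_0_iff)
  then have \<beta>: "(cmod \<beta>)\<^sup>2 = 1" using norm1 by simp
  show thesis
  proof (rule that)
    show "cdot v (tensor a b) = 0"
      by (simp add: ab(1) \<alpha> cdot_simps orthonormal)
    show "ket_bra w = ket_bra (tensor a b)"
      by (simp add: ab(1) \<alpha> ket_bra_scale \<beta>)
    show "L (ket_bra v) = 2"
      using * l by (simp add: \<alpha> \<beta> Lv)
  qed (use ab in auto)
qed

text \<open>The functional \<open>G\<close>, twice the trace minus \<open>L\<close>, is positive and
  vanishes on \<open>v\<close>. So it sees only the part \<open>r\<close> of \<open>u\<close>
  orthogonal to \<open>v\<close>: the value on \<open>u\<close> is at least 1, that on
  \<open>r\<close> at most \<open>2 * (1 - (cmod k)\<^sup>2)\<close>.\<close>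

lemma eigenvector_overlap_le:
  assumes "L (ket_bra v) = 2" "cdot a a = 1" "cdot b b = 1"
  shows "(cmod (cdot v (tensor a b)))\<^sup>2 \<le> 1 / 2"
proof -
  define u where "u = tensor a b"
  define k where "k = cdot v u"
  define r where "r = u - k *s v"
  define G where "G X = 2 * Re (trace X) - L X" for X
  have tr: "linear (\<lambda>X :: two_qubit_op. Re (trace X))"
    by (rule linearI) (simp_all add: trace_def sum.distrib sum_distrib_left)
  then have "linear G"
    unfolding G_def
    by (intro linearI) (simp_all add: linear_add[OF tr] linear_add[OF linear] linear_scale[OF tr]
        linear_scale[OF linear] algebra_simps)
  then have G: "positive_functional G"
    using le_2 by (simp add: positive_functional_def G_def trace_ket_bra)
  have "G (ket_bra (k *s v)) = 0"
    using assms(1) orthonormal(1) by (simp add: positive_functional_scale[OF G]) (simp add: G_def trace_ket_bra)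
  from positive_functional_null[OF G this, of r] have "G (ket_bra u) = G (ket_bra r)"
    by (simp add: r_def)
  moreover have "cdot u u = 1" using assms by (simp add: u_def cdot_tensor)
  moreover have "cdot u v = cnj k" by (simp add: k_def cnj_cdot)
  then have "cdot r r = 1 - k * cnj k"
    unfolding r_def cdot_simps \<open>cdot u u = 1\<close> by (simp add: orthonormal flip: k_def)
  then have "cdot r r = complex_of_real (1 - (cmod k)\<^sup>2)"
    by (simp add: complex_norm_square del: of_real_power)
  moreover have "0 \<le> L (ket_bra r)" by (rule nonneg)
  moreover have "L (ket_bra u) \<le> 1" unfolding u_def using assms by (intro product_le_1)
  ultimately have "2 * (cmod k)\<^sup>2 \<le> 1"
    by (simp add: G_def trace_ket_bra del: of_real_diff of_real_power)
  then show ?thesis by (simp add: k_def u_def)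
qed

end

section \<open>Maximally entangled vectors and averaging over product vectors\<close>

text \<open>In the product basis built from \<open>a\<close> and \<open>b\<close>, \<open>v\<close>
  has coefficients \<open>p\<close>, \<open>q\<close>, \<open>r\<close> off
  \<open>tensor a b\<close>. Suitable product vectors bound both \<open>|q|^2 + |r|^2\<close> and
  \<open>|p|^2 + |r|^2\<close> by 1/2; as the three squares sum to 1, \<open>r\<close> vanishes and
  equality holds.\<close>

lemma maximally_entangled_coefficients:
  assumes ab: "cdot a a = 1" "cdot b b = 1" and v: "cdot v v = 1" "cdot v (tensor a b) = 0"
    and bound: "\<And>c d. cdot c c = 1 \<Longrightarrow> cdot d d = 1 \<Longrightarrow> (cmod (cdot v (tensor c d)))\<^sup>2 \<le> 1 / 2"
  obtains p q where "v = p *s tensor a (orth b) + q *s tensor (orth a) b"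
    "(cmod p)\<^sup>2 = 1 / 2" "(cmod q)\<^sup>2 = 1 / 2"
proof -
  define p where "p = cdot (tensor a (orth b)) v"
  define q where "q = cdot (tensor (orth a) b) v"
  define r where "r = cdot (tensor (orth a) (orth b)) v"
  have conj: "cdot v (tensor a (orth b)) = cnj p" "cdot v (tensor (orth a) b) = cnj q"
    "cdot v (tensor (orth a) (orth b)) = cnj r"
    by (simp_all add: p_def q_def r_def cnj_cdot)
  have "cdot (tensor a b) v = 0" using v(2) by (metis cnj_cdot complex_cnj_zero)
  then have v_eq: "v = p *s tensor a (orth b) + q *s tensor (orth a) b + r *s tensor (orth a) (orth b)"
    using tensor_resolution[OF ab, of v] by (simp add: p_def q_def r_def)
  have "cdot v v = p * cnj p + q * cnj q + r * cnj r"
    by (subst (2) v_eq) (simp add: cdot_simps conj)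
  then have "complex_of_real ((cmod p)\<^sup>2 + (cmod q)\<^sup>2 + (cmod r)\<^sup>2) = 1"
    by (simp add: v complex_norm_square del: of_real_power)
  then have sum1: "(cmod p)\<^sup>2 + (cmod q)\<^sup>2 + (cmod r)\<^sup>2 = 1" by (simp only: of_real_eq_1_iff)
  have P: "positive_functional (\<lambda>X. expct X v)"
    by (simp add: positive_functional_def linear_expct expct_ket_bra)
  have hom: "(cmod (cdot v (tensor c d)))\<^sup>2 \<le> 1 / 2 * (norm c)\<^sup>2 * (norm d)\<^sup>2" for c d
    using positive_functional_product_bound[OF P, of "1 / 2" c d] bound by (simp add: expct_ket_bra)
  have orth1: "cdot (orth a) (orth a) = 1" "cdot (orth b) (orth b) = 1" by (simp_all add: cdot_orth ab)
  have norm1: "norm y = 1" if "cdot y y = 1" for y :: "complex ^ 2"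
    using that unfolding cdot_self of_real_eq_1_iff by (simp add: abs_square_eq_1)
  have half: "s \<le> 1 / 2" if "s\<^sup>2 \<le> 1 / 2 * s" "0 \<le> s" for s :: real
    using that by (cases "s = 0") (auto simp: power2_eq_square)
  have "(cmod q)\<^sup>2 + (cmod r)\<^sup>2 \<le> 1 / 2"
  proof (rule half)
    \<comment> \<open>This choice turns the overlap of \<open>v\<close> with
      \<open>tensor (orth a) z\<close> into the squared norm of \<open>z\<close>. The homogeneous
      bound then reads \<open>s\<^sup>2 \<le> 1 / 2 * s\<close>, and \<open>half\<close> cancels one
      factor.\<close>
    define z where "z = q *s b + r *s orth b"
    have "cdot z z = q * cnj q + r * cnj r"
      unfolding z_def by (simp add: cdot_simps ab cdot_orth)
    then have "complex_of_real ((norm z)\<^sup>2) = complex_of_real ((cmod q)\<^sup>2 + (cmod r)\<^sup>2)"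
      unfolding cdot_self by (simp add: complex_norm_square del: of_real_power)
    then have z: "(norm z)\<^sup>2 = (cmod q)\<^sup>2 + (cmod r)\<^sup>2" by (simp only: of_real_eq_iff)
    have "cdot v (tensor (orth a) z) = complex_of_real ((cmod q)\<^sup>2 + (cmod r)\<^sup>2)"
      by (simp add: z_def tensor_add_right tensor_scale_right cdot_simps conj complex_norm_square del: of_real_power)
    then show "((cmod q)\<^sup>2 + (cmod r)\<^sup>2)\<^sup>2 \<le> 1 / 2 * ((cmod q)\<^sup>2 + (cmod r)\<^sup>2)"
      using hom[of "orth a" z] by (simp only: norm1[OF orth1(1)] z norm_of_real power2_abs) simp
  qed simp
  moreover have "(cmod p)\<^sup>2 + (cmod r)\<^sup>2 \<le> 1 / 2"
  proof (rule half)
    define z where "z = p *s a + r *s orth a"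
    have "cdot z z = p * cnj p + r * cnj r"
      unfolding z_def by (simp add: cdot_simps ab cdot_orth)
    then have "complex_of_real ((norm z)\<^sup>2) = complex_of_real ((cmod p)\<^sup>2 + (cmod r)\<^sup>2)"
      unfolding cdot_self by (simp add: complex_norm_square del: of_real_power)
    then have z: "(norm z)\<^sup>2 = (cmod p)\<^sup>2 + (cmod r)\<^sup>2" by (simp only: of_real_eq_iff)
    have "cdot v (tensor z (orth b)) = complex_of_real ((cmod p)\<^sup>2 + (cmod r)\<^sup>2)"
      by (simp add: z_def tensor_add_left tensor_scale_left cdot_simps conj complex_norm_square del: of_real_power)
    then show "((cmod p)\<^sup>2 + (cmod r)\<^sup>2)\<^sup>2 \<le> 1 / 2 * ((cmod p)\<^sup>2 + (cmod r)\<^sup>2)"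
      using hom[of z "orth b"] by (simp only: norm1[OF orth1(2)] z norm_of_real power2_abs) simp
  qed simp
  ultimately have r0: "(cmod r)\<^sup>2 = 0" and pq: "(cmod p)\<^sup>2 = 1 / 2" "(cmod q)\<^sup>2 = 1 / 2"
    using sum1 zero_le_power2[of "cmod r"] zero_le_power2[of "cmod p"] zero_le_power2[of "cmod q"] by linarith+
  then show thesis using that v_eq by simp
qed

text \<open>Since \<open>\<surd>2 p\<close> and \<open>\<surd>2 q\<close> are phases, the product vectors
  \<open>(a + \<omega> \<surd>2 q a\<^sup>\<bottom>) \<otimes> (b + \<omega> \<surd>2 p b\<^sup>\<bottom>)\<close> have squared norm 4;
  they equal \<open>a \<otimes> b + \<omega> \<surd>2 v + \<omega>\<^sup>2 (\<dots>)\<close>; averaging over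
  \<open>\<omega> \<in> {1, -1, \<i>, -\<i>}\<close> removes the cross terms.\<close>

lemma twirling_bound:
  assumes L: "positive_functional L"
    and product_le: "\<And>c d. cdot c c = 1 \<Longrightarrow> cdot d d = 1 \<Longrightarrow> L (ket_bra (tensor c d)) \<le> 1"
    and ab: "cdot a a = 1" "cdot b b = 1"
    and v: "v = p *s tensor a (orth b) + q *s tensor (orth a) b"
    and pq: "(cmod p)\<^sup>2 = 1 / 2" "(cmod q)\<^sup>2 = 1 / 2"
  shows "L (ket_bra (tensor a b)) + 2 * L (ket_bra v) \<le> 4"
proof -
  define s where "s = complex_of_real (sqrt 2)"
  define A where "A = tensor a b"
  define B where "B = s *s v"
  define C where "C = (s * q * (s * p)) *s tensor (orth a) (orth b)"
  have norm2: "(norm (y + (\<omega> * s * k) *s orth y))\<^sup>2 = 2"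
    if "cdot y y = 1" "cmod \<omega> = 1" "(cmod k)\<^sup>2 = 1 / 2" for y :: "complex ^ 2" and \<omega> k
  proof -
    have "cdot (y + (\<omega> * s * k) *s orth y) (y + (\<omega> * s * k) *s orth y) = 1 + (\<omega> * s * k) * cnj (\<omega> * s * k)"
      unfolding cdot_simps cdot_orth that(1) by simp
    also have "\<dots> = complex_of_real (1 + (cmod (\<omega> * s * k))\<^sup>2)"
      by (simp only: of_real_add of_real_1 complex_norm_square)
    also have "(cmod (\<omega> * s * k))\<^sup>2 = 1"
      using that(2,3) by (simp add: norm_mult power_mult_distrib s_def)
    finally show ?thesis unfolding cdot_self of_real_eq_iff by simp
  qed
  have term_le: "L (ket_bra (A + \<omega> *s B + (\<omega> * \<omega>) *s C)) \<le> 4" if "cmod \<omega> = 1" for \<omega>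
  proof -
    have "A + \<omega> *s B + (\<omega> * \<omega>) *s C = tensor (a + (\<omega> * s * q) *s orth a) (b + (\<omega> * s * p) *s orth b)"
      unfolding A_def B_def C_def v tensor_add_left tensor_add_right tensor_scale_left tensor_scale_right
      by (simp add: vec_eq_iff algebra_simps)
    then show ?thesis
      using positive_functional_product_bound[OF L, of 1 "a + (\<omega> * s * q) *s orth a" "b + (\<omega> * s * p) *s orth b"]
        product_le by (simp add: norm2 ab that pq)
  qed
  have neg: "(- c) *s y = - (c *s y)" for c :: complex and y :: "complex ^ (2 \<times> 2)"
    by (simp add: vec_eq_iff)
  note par = positive_functional_parallelogram[OF L]
  have "L (ket_bra (A + B + C)) \<le> 4" "L (ket_bra (A - B + C)) \<le> 4"
    "L (ket_bra (A + \<i> *s B - C)) \<le> 4" "L (ket_bra (A - \<i> *s B - C)) \<le> 4"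
    using term_le[of 1] term_le[of "- 1"] term_le[of \<i>] term_le[of "- \<i>"]
    by (simp_all add: neg)
  \<comment> \<open>Opposite phases are paired by the parallelogram law: 1 and -1 leave
    \<open>A + C\<close>, while the imaginary pair leaves \<open>A - C\<close>. A third application
    separates \<open>A\<close> from \<open>C\<close>, whose nonnegative contribution is
    dropped.\<close>
  moreover have "L (ket_bra (A + B + C)) + L (ket_bra (A - B + C)) = 2 * L (ket_bra (A + C)) + 2 * L (ket_bra B)"
    using par[of "A + C" B] by (simp add: algebra_simps)
  moreover have "L (ket_bra (A + \<i> *s B - C)) + L (ket_bra (A - \<i> *s B - C))
      = 2 * L (ket_bra (A - C)) + 2 * L (ket_bra B)"
    using par[of "A - C" "\<i> *s B"] positive_functional_scale[OF L, of \<i> B] by (simp add: algebra_simps)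
  moreover have "L (ket_bra (A + C)) + L (ket_bra (A - C)) = 2 * L (ket_bra A) + 2 * L (ket_bra C)"
    by (rule par)
  moreover have "L (ket_bra B) = 2 * L (ket_bra v)"
    by (simp add: B_def positive_functional_scale[OF L] s_def)
  moreover have "0 \<le> L (ket_bra C)"
    using L by (simp add: positive_functional_def)
  ultimately show ?thesis unfolding A_def by linarith
qed

section \<open>Combining the two targets\<close>

theorem mainTheorem3:
  fixes lam :: real and S :: "two_qubit_op set"
  assumes "2 / 3 < lam" and "lam < 1"
    and "S = {\<rho> \<in> two_qubit_states. has_spectrum \<rho> [lam, 1 - lam, 0, 0]}"
  shows "\<not> (\<exists>\<rho>\<in>S. \<forall>\<sigma>\<in>S. \<exists>\<Lambda>. non_entangling \<Lambda> \<and> \<Lambda> \<rho> = \<sigma>)"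
proof
  assume "\<exists>\<rho>\<in>S. \<forall>\<sigma>\<in>S. \<exists>\<Lambda>. non_entangling \<Lambda> \<and> \<Lambda> \<rho> = \<sigma>"
  then obtain \<rho> where \<rho>: "\<rho> \<in> S" and reach: "\<And>\<sigma>. \<sigma> \<in> S \<Longrightarrow> \<exists>\<Lambda>. non_entangling \<Lambda> \<and> \<Lambda> \<rho> = \<sigma>"
    by blast
  have \<rho>': "psd \<rho>" "trace \<rho> = 1"
    and spec: "\<And>z. det (mat z - \<rho>) = (\<Prod>e\<leftarrow>[lam, 1 - lam, 0, 0]. z - complex_of_real e)"
    using \<rho> by (auto simp: assms(3) two_qubit_states_def psd_def has_spectrum_def)
  have "lam \<noteq> 1 - lam" using assms(1) by linarith
  moreover have "det (mat (complex_of_real lam) - \<rho>) = 0" "det (mat (complex_of_real (1 - lam)) - \<rho>) = 0"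
    by (simp_all add: spec)
  ultimately obtain v w where vw: "cdot v v = 1" "cdot w w = 1" "cdot v w = 0"
    and \<rho>_eq: "\<rho> = lam *\<^sub>R ket_bra v + (1 - lam) *\<^sub>R ket_bra w"
    using rank_two_spectral_decomposition[OF \<rho>'] by blast
  have reach': "\<exists>\<Lambda>. bell_target \<Lambda> lam m v w x"
    if "x = e12 \<and> m = 1 - lam \<or> x = bell (- 1) \<and> m = (1 - lam) / 2" for x m
  proof -
    have "(lam / 2) *\<^sub>R ket_bra (bell 1) + m *\<^sub>R ket_bra x \<in> S"
      using isospectral_state[OF _ _ that] assms by simp
    from reach[OF this] obtain \<Lambda> where \<Lambda>: "non_entangling \<Lambda>"
      "\<Lambda> \<rho> = (lam / 2) *\<^sub>R ket_bra (bell 1) + m *\<^sub>R ket_bra x" by blast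
    have "cdot (bell 1) x = 0" using that by (auto simp: cdot_bell bell_nth e12_nth)
    with \<Lambda> have "bell_target \<Lambda> lam m v w x"
      by unfold_locales (use vw assms \<rho>_eq in auto)
    then show ?thesis by blast
  qed
  obtain \<Lambda> where "bell_target \<Lambda> lam (1 - lam) v w e12"
    using reach' by blast
  \<comment> \<open>Both interpretations share the eigenvectors \<open>v\<close> and
    \<open>w\<close> of the source, so the structure obtained from \<open>T\<close> can be used to
    bound \<open>T'.L\<close>.\<close>
  then interpret T: bell_target \<Lambda> lam "1 - lam" v w e12 .
  obtain \<Lambda>' where "bell_target \<Lambda>' lam ((1 - lam) / 2) v w (bell (- 1))"
    using reach' by blast
  then interpret T': bell_target \<Lambda>' lam "(1 - lam) / 2" v w "bell (- 1)" .
  obtain a b where ab: "cdot a a = 1" "cdot b b = 1" "cdot v (tensor a b) = 0"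
    "ket_bra w = ket_bra (tensor a b)" "T.L (ket_bra v) = 2"
    using T.product_eigenvector[OF refl] .
  obtain p q where pq: "v = p *s tensor a (orth b) + q *s tensor (orth a) b"
    "(cmod p)\<^sup>2 = 1 / 2" "(cmod q)\<^sup>2 = 1 / 2"
    by (rule maximally_entangled_coefficients[OF ab(1,2) vw(1) ab(3) T.eigenvector_overlap_le[OF ab(5)]])
  have "T'.L (ket_bra w) + 2 * T'.L (ket_bra v) \<le> 4"
    unfolding ab(4) by (rule twirling_bound[OF T'.positive T'.product_le_1 ab(1,2) pq])
  moreover have "T'.L (ket_bra w) = 1"
    unfolding T'.L_def
  proof (rule expct_bell_separable_1)
    show "\<Lambda>' (ket_bra w) \<in> separable_states"
      unfolding ab(4) using ab(1,2) by (rule T'.separable)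
    show "expct (\<Lambda>' (ket_bra w)) e21 = 0" "expct (\<Lambda>' (ket_bra w)) e12 = 0"
      using T'.null[of e21 0 1] T'.null[of e12 0 1] by (simp_all add: cdot_e21 cdot_e12 bell_nth)
  qed
  \<comment> \<open>From \<open>1 + 2 * T'.L (ket_bra v) \<le> 4\<close>. Inserted in
    \<open>target_value\<close>, it gives \<open>2 * lam \<le> 3 / 2 * lam + 1 - lam\<close>, that
    is, \<open>lam \<le> 2 / 3\<close>.\<close>
  ultimately have "lam * T'.L (ket_bra v) \<le> lam * (3 / 2)"
    using assms(1) by (intro mult_left_mono) auto
  moreover have "lam * T'.L (ket_bra v) + (1 - lam) = 2 * lam"
    using T'.target_value by (simp only: \<open>T'.L (ket_bra w) = 1\<close> mult_1_right)
  ultimately show False using assms(1) by linarith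
qed

end
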